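(* Let $X\subseteq\{0,1\}^n$, $\ell(\mathbf x,\mathbf c)=\mathbf c^\top\mathbf x$, let the support set be $\mathcal S_0=\{\mathbf c'\in\mathbb R^n:\mathbf l\le\mathbf c'\le\mathbf u\}$ with $\mathbf 0\le\mathbf l\le\mathbf u$, and let the data constraints be $\mathcal S_k=\{\mathbf c'\in\mathbb R^n:\mathbf l^{(k)}\le\mathbf c'\le\mathbf u^{(k)}\}$ with $\mathbf l\le\mathbf l^{(k)}\le\mathbf u^{(k)}\le\mathbf u$, for every $k\in\mathcal K$. Then the optimal objective function value of the three-level problem $$\min_{\mathbf{x} \in X}\ \max_{\widehat{\mathbf{C}}} \Big\{ \max_{\mathbb{Q} \in \mathcal{Q}(\widehat{\mathbf{C}})} \mathbb{E}_{\mathbb{Q}} \{\ell(\mathbf{x}, \mathbf{c})\}:\ \hat{\mathbf{c}}^{(k)} \in \mathcal{S}_k \ \ \forall k \in \mathcal{K} \Big\}$$ coincides with the smaller of the optimal values of the two problems $$\min_{\mathbf{x} \in X}\ \frac{1}{K}\sum_{k = 1}^K \mathbf{u}^{(k)\top} \mathbf{x} + \varepsilon_K \qquad\text{and}\qquad \min_{\mathbf{x} \in X}\ \mathbf{u}^\top \mathbf{x}.$$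
   Context: $K\ge1$ is an integer, $\mathcal K=\{1,\dots,K\}$, and vector inequalities are component-wise; $\mathbf l,\mathbf u,\mathbf l^{(k)},\mathbf u^{(k)}\in\mathbb R^n$. The minimum over an empty set is $+\infty$. Data set: $\widehat{\mathbf C}=(\hat{\mathbf c}^{(1)},\dots,\hat{\mathbf c}^{(K)})$ with $\hat{\mathbf c}^{(k)}\in\mathbb R^n$; its empirical distribution is $\widehat{\mathbb Q}_K=\frac1K\sum_{k=1}^K\delta_{\hat{\mathbf c}^{(k)}}$, where $\delta_{\mathbf z}$ is the Dirac point mass at $\mathbf z$. Ambiguity set: $\mathcal Q_0(\mathcal S_0)$ is the set of probability distributions supported on $\mathcal S_0$. The type-1 Wasserstein distance with respect to the $l_1$-norm is $$W^1(\mathbb Q,\mathbb Q')=\inf_{\pi\in\Pi(\mathbb Q,\mathbb Q')}\int_{\mathcal S_0\times\mathcal S_0}\|\mathbf c-\mathbf c'\|_1\,\pi(\mathrm d\mathbf c,\mathrm d\mathbf c'),$$ where $\Pi(\mathbb Q,\mathbb Q')$ is the set of joint distributions on $\mathcal S_0\times\mathcal S_0$ with marginals $\mathbb Q$ and $\mathbb Q'$. For a given radius $\varepsilon_K>0$, $$\mathcal Q(\widehat{\mathbf C})=\{\mathbb Q\in\mathcal Q_0(\mathcal S_0):\ W^1(\widehat{\mathbb Q}_K,\mathbb Q)\le\varepsilon_K\}.$$ *)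

theory Defs
  imports "HOL-Probability.Probability"
begin

definition l1_norm :: "real ^ 'n \<Rightarrow> real" where
  "l1_norm c = (\<Sum>i\<in>UNIV. \<bar>c $ i\<bar>)"

text \<open>Distributions on \<open>\<real>\<^sup>n\<close> are Borel measures on the whole space; being supported on \<open>S0\<close>
  means giving \<open>S0\<close> full mass. Likewise for joint distributions and \<open>S0 \<times> S0\<close>.\<close>

definition distributions_on :: "(real ^ 'n) set \<Rightarrow> (real ^ 'n) measure set" where
  "distributions_on S0 = {Q. prob_space Q \<and> sets Q = sets borel \<and> emeasure Q S0 = 1}"

definition couplings ::
  "(real ^ 'n) set \<Rightarrow> (real ^ 'n) measure \<Rightarrow> (real ^ 'n) measure \<Rightarrow>
    ((real ^ 'n) \<times> (real ^ 'n)) measure set" where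
  "couplings S0 Q Q' =
    {p. prob_space p \<and> sets p = sets (borel \<Otimes>\<^sub>M borel) \<and> emeasure p (S0 \<times> S0) = 1 \<and>
        distr p borel fst = Q \<and> distr p borel snd = Q'}"

text \<open>The value is an extended nonnegative real, so it is infinite if there is no coupling.\<close>

definition wasserstein1 ::
  "(real ^ 'n) set \<Rightarrow> (real ^ 'n) measure \<Rightarrow> (real ^ 'n) measure \<Rightarrow> ennreal" where
  "wasserstein1 S0 Q Q' =
    (INF p\<in>couplings S0 Q Q'.
      \<integral>\<^sup>+z\<in>S0 \<times> S0. ennreal (l1_norm (fst z - snd z)) \<partial>p)"

definition empirical_distribution ::
  "nat \<Rightarrow> (nat \<Rightarrow> real ^ 'n) \<Rightarrow> (real ^ 'n) measure" where
  "empirical_distribution K C =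
    measure_of UNIV (sets borel)
      (\<lambda>A. ennreal (1 / real K) * (\<Sum>k=1..K. emeasure (return borel (C k)) A))"

text \<open>The set function above is indeed a measure on the Borel sets, so \<^const>\<open>measure_of\<close>
  does not fall back to the zero measure.\<close>

lemma sets_empirical_distribution [simp]:
  fixes C :: "nat \<Rightarrow> real ^ 'n"
  shows "sets (empirical_distribution K C) = sets borel"
proof -
  have "sigma_algebra UNIV (sets (borel :: (real ^ 'n) measure))"
    using sets.sigma_algebra_axioms[of "borel :: (real ^ 'n) measure"] by simp
  then show ?thesis
    unfolding empirical_distribution_def
    using sigma_algebra.sigma_sets_eq by (simp add: sets_measure_of_conv) blast
qed

lemma space_empirical_distribution [simp]: "space (empirical_distribution K C) = UNIV"
  unfolding empirical_distribution_def by (simp add: space_measure_of_conv)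

lemma emeasure_empirical_distribution:
  fixes C :: "nat \<Rightarrow> real ^ 'n"
  assumes A: "A \<in> sets borel"
  shows "emeasure (empirical_distribution K C) A =
    ennreal (1 / real K) * (\<Sum>k=1..K. emeasure (return borel (C k)) A)"
proof (rule emeasure_measure_of[OF empirical_distribution_def])
  let ?f = "\<lambda>A. ennreal (1 / real K) * (\<Sum>k=1..K. emeasure (return borel (C k)) A)"
  show "countably_additive (sets (empirical_distribution K C)) ?f"
  proof (rule countably_additiveI)
    fix B :: "nat \<Rightarrow> (real ^ 'n) set"
    assume B: "range B \<subseteq> sets (empirical_distribution K C)" "disjoint_family B"
    have "(\<Sum>i. emeasure (return borel (C k)) (B i)) = emeasure (return borel (C k)) (\<Union>i. B i)"
      for k using B by (intro suminf_emeasure) auto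
    then show "(\<Sum>i. ?f (B i)) = ?f (\<Union>i. B i)"
      by (simp add: ennreal_suminf_cmult suminf_sum)
  qed
qed (use A in \<open>auto simp: positive_def\<close>)

lemma prob_space_empirical_distribution:
  assumes "K \<ge> 1"
  shows "prob_space (empirical_distribution K C)"
proof (rule prob_spaceI)
  have "ennreal (1 / real K) * of_nat K = 1"
    using assms by (simp add: ennreal_of_nat_eq_real_of_nat flip: ennreal_mult')
  then show "emeasure (empirical_distribution K C) (space (empirical_distribution K C)) = 1"
    by (simp add: emeasure_empirical_distribution)
qed

definition ambiguity_set ::
  "(real ^ 'n) set \<Rightarrow> real \<Rightarrow> nat \<Rightarrow> (nat \<Rightarrow> real ^ 'n) \<Rightarrow> (real ^ 'n) measure set" where
  "ambiguity_set S0 eps K C =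
    {Q \<in> distributions_on S0. wasserstein1 S0 (empirical_distribution K C) Q \<le> ennreal eps}"

definition loss :: "real ^ 'n \<Rightarrow> real ^ 'n \<Rightarrow> real" where
  "loss x c = c \<bullet> x"

text \<open>Optimal values live in the extended reals, so a minimum over the empty set is \<open>\<infinity>\<close>. A data
  set is an element of the product of the sets \<open>S k\<close>, \<open>k \<in> {1..K}\<close>.\<close>

definition three_level_value ::
  "(real ^ 'n) set \<Rightarrow> (real ^ 'n) set \<Rightarrow> real \<Rightarrow> nat \<Rightarrow> (nat \<Rightarrow> (real ^ 'n) set) \<Rightarrow> ereal" where
  "three_level_value X S0 eps K S =
    (INF x\<in>X. SUP C\<in>Pi\<^sub>E {1..K} S. SUP Q\<in>ambiguity_set S0 eps K C.
      ereal (\<integral>c. loss x c \<partial>Q))"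

end

theory Submission
  imports Defs
begin

text \<open>For binary \<open>x\<close> the map \<open>c \<mapsto> c \<bullet> x\<close> is 1-Lipschitz in the \<open>l\<^sub>1\<close>-norm, so no distribution
  within distance \<open>eps\<close> of the data raises the mean loss by more than \<open>eps\<close>, nor above \<open>u \<bullet> x\<close>.
  Both bounds are met by taking each data point at its upper bound \<open>uk k\<close> and moving it
  towards \<open>u\<close> in the coordinates selected by \<open>x\<close>, with a common step length \<open>t\<close>.\<close>

section \<open>Empirical distributions as push-forwards of the uniform law on indices\<close>

text \<open>Drawing an index uniformly and reading off its data point gives mass
  \<open>1 / K\<close> to each point. In this form integrals become finite averages, and couplings
  can be built from pairs of data sets.\<close>

lemma empirical_distribution_eq_distr:
  fixes C :: "nat \<Rightarrow> real ^ 'n"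
  assumes "K \<ge> 1"
  shows "empirical_distribution K C = distr (measure_pmf (pmf_of_set {1..K})) borel C"
proof (rule measure_eqI)
  fix A assume "A \<in> sets (empirical_distribution K C)"
  then have A: "A \<in> sets borel" by simp
  have "emeasure (distr (measure_pmf (pmf_of_set {1..K})) borel C) A =
      (\<integral>\<^sup>+k. indicator A (C k) \<partial>measure_pmf (pmf_of_set {1..K}))"
    using A nn_integral_distr[of C "measure_pmf (pmf_of_set {1..K})" borel "indicator A"] by simp
  also have "\<dots> = (\<Sum>k=1..K. indicator A (C k)) / of_nat K"
    using assms by (subst nn_integral_pmf_of_set) auto
  also have "\<dots> = ennreal (1 / real K) * (\<Sum>k=1..K. emeasure (return borel (C k)) A)"
    using assms A
    by (simp add: divide_ennreal_def inverse_ennreal ennreal_of_nat_eq_real_of_nat mult.commute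
        field_simps)
  finally show "emeasure (empirical_distribution K C) A =
      emeasure (distr (measure_pmf (pmf_of_set {1..K})) borel C) A"
    using A by (simp add: emeasure_empirical_distribution)
qed simp

lemma nn_integral_empirical_distribution:
  fixes C :: "nat \<Rightarrow> real ^ 'n" and f :: "real ^ 'n \<Rightarrow> real"
  assumes "K \<ge> 1" and "f \<in> borel_measurable borel" and "\<And>k. k \<in> {1..K} \<Longrightarrow> 0 \<le> f (C k)"
  shows "(\<integral>\<^sup>+c. ennreal (f c) \<partial>empirical_distribution K C) =
    ennreal (1 / real K * (\<Sum>k=1..K. f (C k)))"
proof -
  have "(\<integral>\<^sup>+c. ennreal (f c) \<partial>empirical_distribution K C) =
      (\<Sum>k=1..K. ennreal (f (C k))) / of_nat K"
    using assms
    by (simp add: empirical_distribution_eq_distr nn_integral_distr nn_integral_pmf_of_set)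
  also have "(\<Sum>k=1..K. ennreal (f (C k))) = ennreal (\<Sum>k=1..K. f (C k))"
    using assms by (intro sum_ennreal) auto
  moreover have "0 \<le> (\<Sum>k=1..K. f (C k))"
    using assms(3) by (rule sum_nonneg)
  ultimately show ?thesis
    using assms(1) by (simp add: ennreal_of_nat_eq_real_of_nat divide_ennreal)
qed

lemma integral_empirical_distribution:
  fixes C :: "nat \<Rightarrow> real ^ 'n" and f :: "real ^ 'n \<Rightarrow> real"
  assumes "K \<ge> 1" and "f \<in> borel_measurable borel"
  shows "(\<integral>c. f c \<partial>empirical_distribution K C) = 1 / real K * (\<Sum>k=1..K. f (C k))"
  using assms by (simp add: empirical_distribution_eq_distr integral_distr integral_pmf_of_set)

section \<open>The \<open>l1_norm\<close> and the component-wise order\<close>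

text \<open>Each summand is either 0 or \<open>d $ i\<close>. Applied to differences of cost
  vectors, this is the 1-Lipschitz property of the loss.\<close>

lemma inner_le_l1_norm:
  fixes x d :: "real ^ 'n"
  assumes "\<forall>i. x $ i \<in> {0, 1}"
  shows "d \<bullet> x \<le> l1_norm d"
  unfolding l1_norm_def inner_vec_def
proof (rule sum_mono)
  fix i show "d $ i \<bullet> x $ i \<le> \<bar>d $ i\<bar>"
    using assms[rule_format, of i] by auto
qed

lemma l1_norm_minus_commute: "l1_norm (a - b) = l1_norm (b - a)"
  by (simp add: l1_norm_def abs_minus_commute)

lemma l1_norm_measurable [measurable]:
  "(l1_norm :: real ^ 'n \<Rightarrow> real) \<in> borel_measurable borel"
  unfolding l1_norm_def by (intro borel_measurable_continuous_onI continuous_intros)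

lemma vec_inner_mono:
  fixes a b x :: "real ^ 'n"
  assumes "a \<le> b" and "0 \<le> x"
  shows "a \<bullet> x \<le> b \<bullet> x"
  using assms unfolding inner_vec_def less_eq_vec_def
  by (auto intro!: sum_mono mult_right_mono)

lemma order_interval_borel [measurable]: "{c :: real ^ 'n. l \<le> c \<and> c \<le> u} \<in> sets borel"
proof -
  have "{c. l \<le> c \<and> c \<le> u} = cbox l u"
    by (auto simp: less_eq_vec_def mem_box_cart)
  then show ?thesis by simp
qed

section \<open>Bounds on the Wasserstein distance and membership in the ambiguity set\<close>

text \<open>The easy half of Kantorovich duality, for the test function
  \<open>c \<bullet> x\<close>: integrate the Lipschitz inequality against an arbitrary coupling.
  Nonnegativity on \<open>S0\<close> keeps \<open>ennreal\<close> from truncating the values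
  there.\<close>

lemma wasserstein1_dual_bound:
  fixes x :: "real ^ 'n"
  assumes x: "\<forall>i. x $ i \<in> {0, 1}"
    and S0: "S0 \<in> sets borel"
    and nonneg: "\<And>c. c \<in> S0 \<Longrightarrow> 0 \<le> c \<bullet> x"
  shows "(\<integral>\<^sup>+c. ennreal (c \<bullet> x) \<partial>Q) \<le>
    wasserstein1 S0 P Q + (\<integral>\<^sup>+c. ennreal (c \<bullet> x) \<partial>P)"
proof (cases "(\<integral>\<^sup>+c. ennreal (c \<bullet> x) \<partial>P) = \<top>")
  case False
  \<comment> \<open>The finite integral over \<open>P\<close> is moved to the left, so that a
    quantity independent of the coupling has to lie below every transport cost, hence below their
    infimum.\<close>
  have "(\<integral>\<^sup>+c. ennreal (c \<bullet> x) \<partial>Q) - (\<integral>\<^sup>+c. ennreal (c \<bullet> x) \<partial>P) \<le> wasserstein1 S0 P Q"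
    unfolding wasserstein1_def
  proof (rule INF_greatest)
    fix p assume "p \<in> couplings S0 P Q"
    then have p: "prob_space p" and sets_p: "sets p = sets (borel \<Otimes>\<^sub>M borel)"
      and supp: "emeasure p (S0 \<times> S0) = 1"
      and P: "P = distr p borel fst" and Q: "Q = distr p borel snd"
      by (auto simp: couplings_def)
    interpret prob_space p by (rule p)
    note sets_p [measurable_cong]
    note S0 [measurable]
    have "S0 \<times> S0 \<in> events" unfolding sets_p by measurable
    then have supp_AE: "AE z in p. z \<in> S0 \<times> S0"
      using supp by (subst AE_in_set_eq_1) (simp_all add: measure_def)
    have "(\<integral>\<^sup>+c. ennreal (c \<bullet> x) \<partial>Q) = (\<integral>\<^sup>+z. ennreal (snd z \<bullet> x) \<partial>p)"
      unfolding Q by (rule nn_integral_distr) measurable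
    also have "\<dots> \<le> (\<integral>\<^sup>+z. ennreal (fst z \<bullet> x) +
        ennreal (l1_norm (fst z - snd z)) * indicator (S0 \<times> S0) z \<partial>p)"
      using supp_AE
    proof (intro nn_integral_mono_AE, eventually_elim)
      fix z assume z: "z \<in> S0 \<times> S0"
      then have "snd z \<bullet> x \<le> fst z \<bullet> x + l1_norm (fst z - snd z)" "0 \<le> fst z \<bullet> x"
        using inner_le_l1_norm[OF x, of "snd z - fst z"] nonneg
        by (auto simp: inner_diff_left l1_norm_minus_commute[of "fst z"])
      then show "ennreal (snd z \<bullet> x) \<le> ennreal (fst z \<bullet> x) +
          ennreal (l1_norm (fst z - snd z)) * indicator (S0 \<times> S0) z"
        using z by (simp add: l1_norm_def sum_nonneg flip: ennreal_plus)
    qed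
    also have "\<dots> = (\<integral>\<^sup>+z. ennreal (fst z \<bullet> x) \<partial>p) +
        (\<integral>\<^sup>+z\<in>S0 \<times> S0. ennreal (l1_norm (fst z - snd z)) \<partial>p)"
      by (rule nn_integral_add) measurable
    also have "(\<integral>\<^sup>+z. ennreal (fst z \<bullet> x) \<partial>p) = (\<integral>\<^sup>+c. ennreal (c \<bullet> x) \<partial>P)"
      unfolding P by (rule nn_integral_distr[symmetric]) measurable
    finally show "(\<integral>\<^sup>+c. ennreal (c \<bullet> x) \<partial>Q) - (\<integral>\<^sup>+c. ennreal (c \<bullet> x) \<partial>P) \<le>
        (\<integral>\<^sup>+z\<in>S0 \<times> S0. ennreal (l1_norm (fst z - snd z)) \<partial>p)"
      using False by (simp add: ennreal_minus_le_iff)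
  qed
  then show ?thesis
    using False by (simp add: ennreal_minus_le_iff add.commute)
qed simp

text \<open>Any coupling bounds the infimum from above; the one used sends \<open>C k\<close> to
  \<open>D k\<close> for each index, carrying mass \<open>1 / K\<close>.\<close>

lemma wasserstein1_empirical_le:
  fixes C D :: "nat \<Rightarrow> real ^ 'n"
  assumes "K \<ge> 1" and S0 [measurable]: "S0 \<in> sets borel"
    and C: "\<And>k. k \<in> {1..K} \<Longrightarrow> C k \<in> S0" and D: "\<And>k. k \<in> {1..K} \<Longrightarrow> D k \<in> S0"
  shows "wasserstein1 S0 (empirical_distribution K C) (empirical_distribution K D) \<le>
    ennreal (1 / real K * (\<Sum>k=1..K. l1_norm (C k - D k)))"
proof -
  let ?M = "measure_pmf (pmf_of_set {1..K})"
  \<comment> \<open>One random index drives both coordinates, so the marginals are the two empirical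
    distributions.\<close>
  define p where "p = distr ?M (borel \<Otimes>\<^sub>M borel) (\<lambda>k. (C k, D k))"
  have pair: "(\<lambda>k. (C k, D k)) \<in> ?M \<rightarrow>\<^sub>M borel \<Otimes>\<^sub>M borel"
    by (simp add: space_pair_measure)
  have "prob_space p"
    unfolding p_def by (rule measure_pmf.prob_space_distr) (rule pair)
  moreover have "emeasure p (S0 \<times> S0) = 1"
  proof -
    have "emeasure p (S0 \<times> S0) = emeasure ?M ((\<lambda>k. (C k, D k)) -` (S0 \<times> S0))"
      unfolding p_def by (subst emeasure_distr[OF pair]) simp_all
    also have "\<dots> = 1"
      using assms by (subst measure_pmf.emeasure_eq_1_AE) (auto simp: AE_measure_pmf_iff)
    finally show ?thesis .
  qed
  moreover have "distr p borel fst = empirical_distribution K C"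
    "distr p borel snd = empirical_distribution K D"
    using \<open>K \<ge> 1\<close> distr_distr[OF measurable_fst pair] distr_distr[OF measurable_snd pair]
    by (simp_all add: p_def comp_def empirical_distribution_eq_distr)
  ultimately have "p \<in> couplings S0 (empirical_distribution K C) (empirical_distribution K D)"
    by (simp add: couplings_def p_def)
  then have "wasserstein1 S0 (empirical_distribution K C) (empirical_distribution K D) \<le>
      (\<integral>\<^sup>+z\<in>S0 \<times> S0. ennreal (l1_norm (fst z - snd z)) \<partial>p)"
    unfolding wasserstein1_def by (rule INF_lower)
  also have "\<dots> \<le> (\<integral>\<^sup>+z. ennreal (l1_norm (fst z - snd z)) \<partial>p)"
    by (intro nn_integral_mono) (auto simp: indicator_def)
  also have "\<dots> = (\<integral>\<^sup>+k. ennreal (l1_norm (C k - D k)) \<partial>?M)"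
    unfolding p_def by (subst nn_integral_distr[OF pair]) simp_all
  also have "\<dots> = ennreal (\<Sum>k=1..K. l1_norm (C k - D k)) / of_nat K"
    using assms by (subst nn_integral_pmf_of_set) (auto simp: l1_norm_def sum_nonneg)
  also have "\<dots> = ennreal (1 / real K * (\<Sum>k=1..K. l1_norm (C k - D k)))"
    using assms
    by (simp add: ennreal_of_nat_eq_real_of_nat divide_ennreal sum_nonneg l1_norm_def)
  finally show ?thesis .
qed

lemma empirical_distribution_in_distributions_on:
  fixes D :: "nat \<Rightarrow> real ^ 'n"
  assumes "K \<ge> 1" and S0 [measurable]: "S0 \<in> sets borel"
    and "\<And>k. k \<in> {1..K} \<Longrightarrow> D k \<in> S0"
  shows "empirical_distribution K D \<in> distributions_on S0"
proof -
  have "emeasure (empirical_distribution K D) S0 =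
      emeasure (measure_pmf (pmf_of_set {1..K})) (D -` S0)"
    using assms by (simp add: empirical_distribution_eq_distr emeasure_distr)
  also have "\<dots> = 1"
    using assms by (subst measure_pmf.emeasure_eq_1_AE) (auto simp: AE_measure_pmf_iff)
  finally show ?thesis
    using assms prob_space_empirical_distribution by (simp add: distributions_on_def)
qed

section \<open>The worst-case expectation for fixed \<open>x\<close> and fixed data\<close>

text \<open>The first bound comes from the duality estimate with radius \<open>eps\<close>, the
  second from \<open>Q\<close> being carried by vectors below \<open>u\<close>. Both are proved for
  nonnegative integrals and then transferred.\<close>

lemma expected_loss_le:
  fixes x l u :: "real ^ 'n" and C :: "nat \<Rightarrow> real ^ 'n"
  assumes "K \<ge> 1" and "0 \<le> eps" and x: "\<forall>i. x $ i \<in> {0, 1}" and "0 \<le> l" and "l \<le> u"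
    and C: "\<And>k. k \<in> {1..K} \<Longrightarrow> l \<le> C k"
    and Q: "Q \<in> ambiguity_set {c. l \<le> c \<and> c \<le> u} eps K C"
  shows "(\<integral>c. loss x c \<partial>Q) \<le> min (1 / real K * (\<Sum>k=1..K. C k \<bullet> x) + eps) (u \<bullet> x)"
proof -
  let ?S = "{c. l \<le> c \<and> c \<le> u}"
  let ?P = "empirical_distribution K C"
  let ?m = "1 / real K * (\<Sum>k=1..K. C k \<bullet> x)"
  have x0: "0 \<le> x"
    unfolding less_eq_vec_def
  proof
    fix i show "0 $ i \<le> x $ i" using x[rule_format, of i] by auto
  qed
  have nonneg: "0 \<le> c \<bullet> x" if "l \<le> c" for c
    using vec_inner_mono[OF _ x0, of 0 c] that \<open>0 \<le> l\<close> by auto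
  from Q have "prob_space Q" and [measurable_cong]: "sets Q = sets borel"
    and supp: "emeasure Q ?S = 1" and W: "wasserstein1 ?S ?P Q \<le> ennreal eps"
    by (auto simp: ambiguity_set_def distributions_on_def)
  interpret prob_space Q by fact
  have supp_AE: "AE c in Q. c \<in> ?S"
    using supp by (subst AE_in_set_eq_1) (simp_all add: measure_def)
  have m0: "0 \<le> ?m"
    using C by (intro mult_nonneg_nonneg sum_nonneg nonneg) auto
  have u0: "0 \<le> u \<bullet> x"
    using nonneg[OF \<open>l \<le> u\<close>] .
  have "(\<integral>\<^sup>+c. ennreal (c \<bullet> x) \<partial>Q) \<le> wasserstein1 ?S ?P Q + (\<integral>\<^sup>+c. ennreal (c \<bullet> x) \<partial>?P)"
    by (rule wasserstein1_dual_bound[OF x]) (auto intro: nonneg)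
  also have "\<dots> \<le> ennreal eps + ennreal ?m"
    using W C \<open>K \<ge> 1\<close> by (subst nn_integral_empirical_distribution) (auto intro: nonneg add_mono)
  also have "\<dots> = ennreal (?m + eps)"
    using m0 \<open>0 \<le> eps\<close> by (subst ennreal_plus[symmetric]) (auto simp: add.commute)
  finally have le_m: "(\<integral>\<^sup>+c. ennreal (c \<bullet> x) \<partial>Q) \<le> ennreal (?m + eps)" .
  have "(\<integral>\<^sup>+c. ennreal (c \<bullet> x) \<partial>Q) \<le> (\<integral>\<^sup>+c. ennreal (u \<bullet> x) \<partial>Q)"
    using supp_AE
    by (intro nn_integral_mono_AE, eventually_elim) (auto intro!: ennreal_leI vec_inner_mono x0)
  then have le_u: "(\<integral>\<^sup>+c. ennreal (c \<bullet> x) \<partial>Q) \<le> ennreal (u \<bullet> x)"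
    by (simp add: emeasure_space_1)
  \<comment> \<open>The loss is nonnegative almost everywhere because \<open>0 \<le> l\<close> and
    \<open>x\<close> is binary, so the Bochner integral inherits the finite bounds
    \<open>le_m\<close> and \<open>le_u\<close>.\<close>
  have "(\<integral>c. loss x c \<partial>Q) = enn2real (\<integral>\<^sup>+c. ennreal (c \<bullet> x) \<partial>Q)"
    unfolding loss_def
  proof (rule integral_eq_nn_integral)
    show "AE c in Q. 0 \<le> c \<bullet> x"
      using supp_AE by eventually_elim (auto intro: nonneg)
  qed measurable
  then show ?thesis
    using le_m le_u m0 u0 \<open>0 \<le> eps\<close> by (auto intro!: enn2real_leI)
qed

text \<open>The witness is the empirical distribution of a shifted data set. Shifting upwards only
  where \<open>x\<close> is 1 makes the transport cost equal to the gain in mean loss, so no part of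
  the budget \<open>eps\<close> is wasted.\<close>

lemma exists_worst_case_distribution:
  fixes x l u :: "real ^ 'n" and C :: "nat \<Rightarrow> real ^ 'n"
  assumes "K \<ge> 1" and "0 < eps" and x: "\<forall>i. x $ i \<in> {0, 1}"
    and C: "\<And>k. k \<in> {1..K} \<Longrightarrow> l \<le> C k \<and> C k \<le> u"
  shows "\<exists>Q\<in>ambiguity_set {c. l \<le> c \<and> c \<le> u} eps K C.
    (\<integral>c. loss x c \<partial>Q) = min (1 / real K * (\<Sum>k=1..K. C k \<bullet> x) + eps) (u \<bullet> x)"
proof -
  let ?S = "{c. l \<le> c \<and> c \<le> u}"
  let ?m = "1 / real K * (\<Sum>k=1..K. C k \<bullet> x)"
  \<comment> \<open>\<open>g\<close> is the largest gain the box allows. If the budget covers it,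
    the points move all the way (\<open>t = 1\<close>); otherwise \<open>g > eps > 0\<close> and the
    fraction \<open>eps / g\<close> spends the budget exactly.\<close>
  define g where "g = u \<bullet> x - ?m"
  define t where "t = (if g \<le> eps then 1 else eps / g)"
  define D where "D k = (\<chi> i. C k $ i + t * (u $ i - C k $ i) * x $ i)" for k
  have x01: "x $ i = 0 \<or> x $ i = 1" for i
    using x by auto
  have t: "0 \<le> t" "t \<le> 1" and tg: "t * g = min eps g"
    using \<open>0 < eps\<close> by (auto simp: t_def)
  have C_le: "l $ i \<le> C k $ i \<and> C k $ i \<le> u $ i" if "k \<in> {1..K}" for k i
    using C[OF that] by (auto simp: less_eq_vec_def)
  have D_le: "C k $ i \<le> D k $ i \<and> D k $ i \<le> u $ i" if "k \<in> {1..K}" for k i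
  proof -
    have "0 \<le> t * (u $ i - C k $ i)" "t * (u $ i - C k $ i) \<le> 1 * (u $ i - C k $ i)"
      using t C_le[OF that, of i] by (intro mult_nonneg_nonneg mult_right_mono; simp)+
    then show ?thesis
      using x01[of i] C_le[OF that, of i] by (auto simp: D_def)
  qed
  have D_S: "D k \<in> ?S" if "k \<in> {1..K}" for k
    unfolding less_eq_vec_def mem_Collect_eq
    using D_le[OF that] C_le[OF that] order_trans by blast
  have shift: "(\<Sum>i\<in>UNIV. t * (u $ i - C k $ i) * x $ i) = t * (u \<bullet> x - C k \<bullet> x)" for k
    by (simp add: inner_vec_def sum_distrib_left sum_subtractf algebra_simps)
  have D_inner: "D k \<bullet> x = C k \<bullet> x + t * (u \<bullet> x - C k \<bullet> x)" for k
  proof -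
    have "D k \<bullet> x = (\<Sum>i\<in>UNIV. C k $ i * x $ i + t * (u $ i - C k $ i) * x $ i)"
      unfolding inner_vec_def
    proof (rule sum.cong[OF refl])
      \<comment> \<open>The left side contains the square of \<open>x $ i\<close> in its second
        term, which equals \<open>x $ i\<close> for binary entries.\<close>
      fix i show "D k $ i \<bullet> x $ i = C k $ i * x $ i + t * (u $ i - C k $ i) * x $ i"
        using x01[of i] by (auto simp: D_def)
    qed
    then show ?thesis
      unfolding sum.distrib shift by (simp add: inner_vec_def)
  qed
  \<comment> \<open>All coordinates move upwards, so the absolute values open with a fixed sign and
    the cost is the gain found in \<open>D_inner\<close>.\<close>
  have dist: "l1_norm (C k - D k) = t * (u \<bullet> x - C k \<bullet> x)" if "k \<in> {1..K}" for k
  proof -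
    have "l1_norm (C k - D k) = (\<Sum>i\<in>UNIV. D k $ i - C k $ i)"
      unfolding l1_norm_def using D_le[OF that] by (intro sum.cong) auto
    then show ?thesis
      by (simp add: D_def shift)
  qed
  have mean: "1 / real K * (\<Sum>k=1..K. t * (u \<bullet> x - C k \<bullet> x)) = t * g"
    using \<open>K \<ge> 1\<close> by (simp add: g_def sum_subtractf field_simps flip: sum_distrib_left)
  have "wasserstein1 ?S (empirical_distribution K C) (empirical_distribution K D) \<le>
      ennreal (1 / real K * (\<Sum>k=1..K. l1_norm (C k - D k)))"
    using \<open>K \<ge> 1\<close> C D_S by (intro wasserstein1_empirical_le) auto
  also have "(\<Sum>k=1..K. l1_norm (C k - D k)) = (\<Sum>k=1..K. t * (u \<bullet> x - C k \<bullet> x))"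
    by (intro sum.cong dist refl)
  finally have "wasserstein1 ?S (empirical_distribution K C) (empirical_distribution K D) \<le>
      ennreal (t * g)"
    unfolding mean .
  also have "\<dots> \<le> ennreal eps"
    unfolding tg by (intro ennreal_leI) simp
  finally have "empirical_distribution K D \<in> ambiguity_set ?S eps K C"
    using \<open>K \<ge> 1\<close> D_S empirical_distribution_in_distributions_on[of K ?S D]
    by (auto simp: ambiguity_set_def)
  moreover have "(\<integral>c. loss x c \<partial>empirical_distribution K D) = min (?m + eps) (u \<bullet> x)"
  proof -
    have "(\<integral>c. loss x c \<partial>empirical_distribution K D) = 1 / real K * (\<Sum>k=1..K. D k \<bullet> x)"
      using \<open>K \<ge> 1\<close> unfolding loss_def by (intro integral_empirical_distribution) auto
    also have "\<dots> = ?m + t * g"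
      unfolding D_inner sum.distrib distrib_left mean ..
    also have "\<dots> = min (?m + eps) (u \<bullet> x)"
      unfolding tg by (simp add: g_def min_def)
    finally show ?thesis .
  qed
  ultimately show ?thesis by blast
qed

section \<open>Optimizing over the data and over \<open>x\<close>\<close>

theorem theorem2:
  fixes X :: "(real ^ 'n) set"
    and l u :: "real ^ 'n"
    and lk uk :: "nat \<Rightarrow> real ^ 'n"
    and K :: nat
    and eps :: real
  assumes "K \<ge> 1"
    and "eps > 0"
    and "X \<subseteq> {x. \<forall>i. x $ i \<in> {0, 1}}"
    and "0 \<le> l" and "l \<le> u"
    and "\<And>k. k \<in> {1..K} \<Longrightarrow> l \<le> lk k \<and> lk k \<le> uk k \<and> uk k \<le> u"
  shows "three_level_value X {c. l \<le> c \<and> c \<le> u} eps K (\<lambda>k. {c. lk k \<le> c \<and> c \<le> uk k}) =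
    min (INF x\<in>X. ereal (1 / real K * (\<Sum>k=1..K. uk k \<bullet> x) + eps))
        (INF x\<in>X. ereal (u \<bullet> x))"
proof -
  let ?S = "{c. l \<le> c \<and> c \<le> u}"
  let ?Sk = "\<lambda>k. {c. lk k \<le> c \<and> c \<le> uk k}"
  let ?v = "\<lambda>x C. min (1 / real K * (\<Sum>k=1..K. C k \<bullet> x) + eps) (u \<bullet> x)"
  \<comment> \<open>For fixed \<open>x\<close> both inner suprema are attained at the upper data
    bounds \<open>uk\<close>, since \<open>?v x C\<close> is monotone in \<open>C\<close> when
    \<open>x\<close> is nonnegative.\<close>
  have value_x: "(SUP C\<in>Pi\<^sub>E {1..K} ?Sk. SUP Q\<in>ambiguity_set ?S eps K C. ereal (\<integral>c. loss x c \<partial>Q)) =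
      ereal (?v x uk)" if "x \<in> X" for x
  proof (rule antisym)
    have x: "\<forall>i. x $ i \<in> {0, 1}"
      using that assms(3) by blast
    then have x0: "0 \<le> x"
      unfolding less_eq_vec_def by (metis empty_iff insert_iff order_refl zero_index zero_le_one)
    show "(SUP C\<in>Pi\<^sub>E {1..K} ?Sk. SUP Q\<in>ambiguity_set ?S eps K C. ereal (\<integral>c. loss x c \<partial>Q)) \<le>
        ereal (?v x uk)"
    proof (intro SUP_least)
      fix C Q assume C: "C \<in> Pi\<^sub>E {1..K} ?Sk" and Q: "Q \<in> ambiguity_set ?S eps K C"
      have Ck: "lk k \<le> C k \<and> C k \<le> uk k" if "k \<in> {1..K}" for k
        using PiE_mem[OF C that] by simp
      have "(\<integral>c. loss x c \<partial>Q) \<le> ?v x C"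
      proof (rule expected_loss_le[OF _ _ x _ _ _ Q])
        show "l \<le> C k" if "k \<in> {1..K}" for k
          using Ck[OF that] assms(6)[OF that] order_trans by blast
      qed (use assms in auto)
      also have "\<dots> \<le> ?v x uk"
        using Ck by (intro min.mono add_right_mono mult_left_mono sum_mono vec_inner_mono x0) auto
      finally show "ereal (\<integral>c. loss x c \<partial>Q) \<le> ereal (?v x uk)" by simp
    qed
    \<comment> \<open>Elements of \<open>Pi\<^sub>E\<close> must be \<open>undefined\<close> off the
      index set, so \<open>uk\<close> itself need not qualify; \<open>?v\<close> reads only the
      indices in \<open>{1..K}\<close>.\<close>
    define C where "C = restrict uk {1..K}"
    have C: "C \<in> Pi\<^sub>E {1..K} ?Sk"
      unfolding C_def using assms(6) by auto
    have "l \<le> C k \<and> C k \<le> u" if "k \<in> {1..K}" for k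
      unfolding C_def using assms(6)[OF that] that by (auto intro: order_trans)
    then obtain Q where Q: "Q \<in> ambiguity_set ?S eps K C" "(\<integral>c. loss x c \<partial>Q) = ?v x C"
      using exists_worst_case_distribution[OF assms(1,2) x] by blast
    have "?v x C = ?v x uk"
      by (simp add: C_def)
    then have "ereal (?v x uk) = ereal (\<integral>c. loss x c \<partial>Q)"
      by (simp only: Q)
    also have "\<dots> \<le> (SUP Q\<in>ambiguity_set ?S eps K C. ereal (\<integral>c. loss x c \<partial>Q))"
      by (rule SUP_upper) (rule Q)
    also have "\<dots> \<le> (SUP C\<in>Pi\<^sub>E {1..K} ?Sk. SUP Q\<in>ambiguity_set ?S eps K C.
        ereal (\<integral>c. loss x c \<partial>Q))"
      by (rule SUP_upper) (rule C)
    finally show "ereal (?v x uk) \<le> \<dots>" .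
  qed
  have "three_level_value X ?S eps K ?Sk = (INF x\<in>X. ereal (?v x uk))"
    unfolding three_level_value_def by (intro INF_cong refl value_x)
  \<comment> \<open>Infima commute with binary minima, which splits the problem in two. For empty
    \<open>X\<close> both sides are infinite.\<close>
  also have "\<dots> = (INF x\<in>X. inf (ereal (1 / real K * (\<Sum>k=1..K. uk k \<bullet> x) + eps)) (ereal (u \<bullet> x)))"
    by (simp add: inf_min ereal_min)
  also have "\<dots> = min (INF x\<in>X. ereal (1 / real K * (\<Sum>k=1..K. uk k \<bullet> x) + eps))
        (INF x\<in>X. ereal (u \<bullet> x))"
    unfolding INF_inf_distrib[symmetric] by (simp add: inf_min)
  finally show ?thesis .
qed

end
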